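(* Let $n\ge 1$ and let $\{x_1,x_2,\dots,x_m\}$ be any finite subset, with $m$ elements, of real hyperbolic space $H_{\mathbb R}^n$, endowed with the metric $\sqrt d$, where $d$ is the geodesic distance. Then $(\{x_1,\dots,x_m\},\sqrt d)$ embeds isometrically in a euclidean sphere in $\mathbb R^p$ for some $p$, where $p\ge\log_2 m$.
   Context: On $\mathbb R^{n+1}$ consider the form $\langle z,w\rangle=-z^0w^0+z^1w^1+\cdots+z^nw^n$. Real hyperbolic space $H_{\mathbb R}^n$ is the image in projective space $P_{\mathbb R}^n$ of the set of negative vectors $\{x\in\mathbb R^{n+1}:\langle x,x\rangle<0\}$; the same notation is used for a negative vector and its class. The geodesic distance is given by $\cosh d(x,y)=\frac{|\langle x,y\rangle|}{(\langle x,x\rangle\langle y,y\rangle)^{1/2}}$. Isometric embedding in a euclidean sphere in $\mathbb R^p$ means a map $f$ into $\mathbb R^p$ whose image lies on a sphere $\{v\in\mathbb R^p:\|v-c\|=r\}$ and such that $\|f(x_i)-f(x_j)\|=\sqrt{d(x_i,x_j)}$ for all $i,j$, where $\|\cdot\|$ is the euclidean norm of $\mathbb R^p$. *)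

theory Defs
  imports "HOL-Analysis.Analysis"
begin

text \<open>The space \<open>\<real>\<^sup>k\<close> is \<open>topspace (Euclidean_space k)\<close>: the functions
  \<open>nat \<Rightarrow> real\<close> that vanish at all \<open>i \<ge> k\<close>. Coordinates are numbered from \<open>0\<close>.\<close>

definition lorentz :: "nat \<Rightarrow> (nat \<Rightarrow> real) \<Rightarrow> (nat \<Rightarrow> real) \<Rightarrow> real" where
  "lorentz n z w = - (z 0 * w 0) + (\<Sum>i = 1..n. z i * w i)"

text \<open>A point of projective space is the set of all homogeneous coordinate vectors of that point
  (a line through the origin, with the origin removed).\<close>

definition proj_class :: "(nat \<Rightarrow> real) \<Rightarrow> (nat \<Rightarrow> real) set" where
  "proj_class x = {\<lambda>i. c * x i | c. c \<noteq> 0}"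

definition proj_space :: "nat \<Rightarrow> (nat \<Rightarrow> real) set set" where
  "proj_space n = proj_class ` (topspace (Euclidean_space (Suc n)) - {\<lambda>_. 0})"

definition hyp_space :: "nat \<Rightarrow> (nat \<Rightarrow> real) set set" where
  "hyp_space n = proj_class ` {x \<in> topspace (Euclidean_space (Suc n)). lorentz n x x < 0}"

text \<open>The choice of representatives is irrelevant by lemma \<open>hyp_dist_proj_class\<close> below, and
  \<open>cosh_hyp_dist\<close> recovers the defining equation.\<close>

definition hyp_dist :: "nat \<Rightarrow> (nat \<Rightarrow> real) set \<Rightarrow> (nat \<Rightarrow> real) set \<Rightarrow> real" where
  "hyp_dist n X Y =
     (let x = (SOME x. x \<in> X); y = (SOME y. y \<in> Y)
      in arcosh (\<bar>lorentz n x y\<bar> / sqrt (lorentz n x x * lorentz n y y)))"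

definition eucl_dist :: "nat \<Rightarrow> (nat \<Rightarrow> real) \<Rightarrow> (nat \<Rightarrow> real) \<Rightarrow> real" where
  "eucl_dist p u v = L2_set (\<lambda>i. u i - v i) {..<p}"

definition embeds_in_sphere :: "'a set \<Rightarrow> ('a \<Rightarrow> 'a \<Rightarrow> real) \<Rightarrow> nat \<Rightarrow> bool" where
  "embeds_in_sphere S \<delta> p \<longleftrightarrow>
     (\<exists>f c r. r > 0 \<and> c \<in> topspace (Euclidean_space p) \<and>
        (\<forall>x\<in>S. f x \<in> topspace (Euclidean_space p) \<and> eucl_dist p (f x) c = r) \<and>
        (\<forall>x\<in>S. \<forall>y\<in>S. eucl_dist p (f x) (f y) = \<delta> x y))"

lemma hyp_space_subset_proj_space: "hyp_space n \<subseteq> proj_space n"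
  unfolding hyp_space_def proj_space_def by (rule image_mono) (auto simp: lorentz_def)

lemma lorentz_scale: "lorentz n (\<lambda>i. a * x i) (\<lambda>i. b * y i) = a * b * lorentz n x y"
proof -
  have "(\<Sum>i = 1..n. a * x i * (b * y i)) = a * b * (\<Sum>i = 1..n. x i * y i)"
    unfolding sum_distrib_left by (intro sum.cong) auto
  then show ?thesis by (simp add: lorentz_def algebra_simps)
qed

lemma hyp_dist_proj_class:
  "hyp_dist n (proj_class x) (proj_class y) =
     arcosh (\<bar>lorentz n x y\<bar> / sqrt (lorentz n x x * lorentz n y y))"
proof -
  have in_class: "z \<in> proj_class z" for z
    unfolding proj_class_def by (auto intro!: exI[of _ 1])
  define u v where "u = (SOME u. u \<in> proj_class x)" and "v = (SOME v. v \<in> proj_class y)"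
  have "u \<in> proj_class x" "v \<in> proj_class y"
    unfolding u_def v_def using in_class by (metis someI)+
  then obtain a b where ab: "a \<noteq> 0" "b \<noteq> 0"
    and uv: "u = (\<lambda>i. a * x i)" "v = (\<lambda>i. b * y i)"
    unfolding proj_class_def by auto
  have "sqrt (lorentz n u u * lorentz n v v) = sqrt ((a * b)\<^sup>2 * (lorentz n x x * lorentz n y y))"
    by (simp add: uv lorentz_scale power2_eq_square mult_ac)
  also have "\<dots> = \<bar>a * b\<bar> * sqrt (lorentz n x x * lorentz n y y)"
    by (simp only: real_sqrt_mult real_sqrt_abs)
  finally have den: "sqrt (lorentz n u u * lorentz n v v)
      = \<bar>a * b\<bar> * sqrt (lorentz n x x * lorentz n y y)" .
  have "\<bar>lorentz n u v\<bar> = \<bar>a * b\<bar> * \<bar>lorentz n x y\<bar>"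
    by (simp add: uv lorentz_scale abs_mult)
  with den ab show ?thesis
    by (simp add: hyp_dist_def Let_def flip: u_def v_def)
qed

lemma reverse_Cauchy_Schwarz:
  assumes "lorentz n x x < 0" "lorentz n y y < 0"
  shows "lorentz n x x * lorentz n y y \<le> (lorentz n x y)\<^sup>2"
proof -
  define A B C where "A = (\<Sum>i = 1..n. (x i)\<^sup>2)" and "B = (\<Sum>i = 1..n. (y i)\<^sup>2)"
    and "C = (\<Sum>i = 1..n. x i * y i)"
  have CS: "C\<^sup>2 \<le> A * B"
    unfolding A_def B_def C_def by (rule Cauchy_Schwarz_ineq_sum)
  have AB: "A \<ge> 0" "B \<ge> 0"
    unfolding A_def B_def by (auto intro: sum_nonneg)
  have xx: "lorentz n x x = A - (x 0)\<^sup>2" and yy: "lorentz n y y = B - (y 0)\<^sup>2"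
    and xy: "lorentz n x y = C - x 0 * y 0"
    by (simp_all add: lorentz_def A_def B_def C_def power2_eq_square)
  have absC: "\<bar>C\<bar> \<le> sqrt A * sqrt B"
    using CS by (simp add: real_le_rsqrt flip: real_sqrt_mult)
  define P where "P = sqrt A * sqrt B"
  define Q where "Q = \<bar>x 0\<bar> * \<bar>y 0\<bar>"
  have "P \<le> Q"
  proof -
    have "sqrt A \<le> \<bar>x 0\<bar>" "sqrt B \<le> \<bar>y 0\<bar>"
      using assms xx yy by (auto intro!: real_le_lsqrt AB simp: real_sqrt_le_iff)
    then show ?thesis unfolding P_def Q_def by (intro mult_mono) (auto simp: AB)
  qed
  have "Q - P \<le> \<bar>lorentz n x y\<bar>"
    using absC unfolding xy P_def Q_def abs_mult[symmetric] by linarith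
  then have "(Q - P)\<^sup>2 \<le> (lorentz n x y)\<^sup>2"
    using \<open>P \<le> Q\<close> by (metis abs_le_square_iff abs_of_nonneg diff_ge_0_iff_ge)
  moreover have "lorentz n x x * lorentz n y y \<le> (Q - P)\<^sup>2"
  proof -
    have "(Q - P)\<^sup>2 - lorentz n x x * lorentz n y y = (sqrt A * \<bar>y 0\<bar> - sqrt B * \<bar>x 0\<bar>)\<^sup>2"
      unfolding xx yy P_def Q_def
      using AB by (simp add: power2_diff power_mult_distrib algebra_simps)
    then show ?thesis by (metis diff_ge_0_iff_ge zero_le_power2)
  qed
  ultimately show ?thesis by linarith
qed

lemma cosh_hyp_dist:
  assumes "lorentz n x x < 0" "lorentz n y y < 0"
  shows "cosh (hyp_dist n (proj_class x) (proj_class y)) =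
           \<bar>lorentz n x y\<bar> / sqrt (lorentz n x x * lorentz n y y)"
    and "hyp_dist n (proj_class x) (proj_class y) \<ge> 0"
proof -
  define t where "t = \<bar>lorentz n x y\<bar> / sqrt (lorentz n x x * lorentz n y y)"
  have pos: "lorentz n x x * lorentz n y y > 0"
    using assms by (rule mult_neg_neg)
  have "sqrt (lorentz n x x * lorentz n y y) \<le> \<bar>lorentz n x y\<bar>"
    using reverse_Cauchy_Schwarz[OF assms] by (metis real_sqrt_abs real_sqrt_le_mono)
  then have "t \<ge> 1"
    unfolding t_def using pos by (simp add: le_divide_eq)
  then show "cosh (hyp_dist n (proj_class x) (proj_class y)) =
           \<bar>lorentz n x y\<bar> / sqrt (lorentz n x x * lorentz n y y)"
    and "hyp_dist n (proj_class x) (proj_class y) \<ge> 0"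
    unfolding hyp_dist_proj_class t_def[symmetric] by simp_all
qed

end

theory Submission
  imports Defs
begin

text \<open>The claim has two halves that rest on opposite properties of \<open>d\<close>: the embedding exists because
\<open>-d\<close> is positive semidefinite up to an additive constant, and the dimension is bounded below because
\<open>d\<close> satisfies the triangle inequality.

Existence. A sphere of radius \<open>r\<close> around the origin carries vectors \<open>f x\<close> with
\<open>\<parallel>f x - f y\<parallel>\<^sup>2 = d x y\<close> exactly when their Gram matrix is \<open>r\<^sup>2 - d x y / 2\<close>. So it suffices to
find a constant \<open>\<rho> > 0\<close> for which \<open>\<rho> - d / 2\<close> is positive semidefinite
(\<open>psd_on_const_minus_half_hyp_dist\<close>); vectors are then read off from a Cholesky factorization
(\<open>psd_on_gram\<close>). Represent points on the upper sheet of the hyperboloid and put \<open>B = cosh d\<close>. In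
terms of the Klein model, \<open>B x y = w x * w y * (1 - t x y)\<close>, where \<open>w x\<close> is the time coordinate and
\<open>t\<close> is the euclidean inner product of points of the open unit ball. With \<open>q = 1 / B\<^sup>2\<close> and
\<open>r = 1 - sqrt (1 - q)\<close>,
\<open>d = arcosh B = ln 2 + ln B + ln (1 - r / 2)\<close> and \<open>ln B = ln (w x) + ln (w y) + ln (1 - t)\<close>.
The power series of \<open>- ln (1 - s)\<close>, \<open>1 / (1 - s)\<close> and \<open>1 - sqrt (1 - s)\<close> have nonnegative
coefficients, so by the Schur product theorem \<open>- ln (1 - t)\<close>, \<open>q\<close>, \<open>r\<close> and \<open>h = - ln (1 - r / 2)\<close>
are positive semidefinite. The only part of \<open>-d\<close> left over is \<open>- ln 2 - ln (w x) - ln (w y)\<close>. A large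
constant compensates it, provided that some positive multiple of the identity matrix can be spared:
\<open>h\<close> dominates a positive multiple of every power of \<open>q\<close>, and since \<open>q\<close> is \<open>1\<close> on the diagonal and
smaller than \<open>1\<close> elsewhere, its high powers tend to the identity matrix of the finite point set.

Lower bound. If \<open>\<parallel>f x - f y\<parallel>\<^sup>2\<close> is a metric, then by the law of cosines no three of the points span
an obtuse angle, and a theorem of Danzer and Gruenbaum bounds the number of such points in dimension
\<open>p\<close> by \<open>2 ^ p\<close> (\<open>card_le_if_no_obtuse_angle\<close>). It is proved here by counting in place of volumes.
For a word \<open>a\<close> of length \<open>N\<close> over the \<open>m\<close> points consider the sum of the \<open>2 ^ k * f (a k)\<close>. These
\<open>m ^ N\<close> sums keep a positive distance that is independent of \<open>N\<close>
(\<open>dyadic_sums_separated\<close>), but they lie in a cube whose side grows like \<open>2 ^ N\<close>. So \<open>m ^ N\<close> is at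
most a constant times \<open>(2 ^ p) ^ N\<close>, for every \<open>N\<close>.\<close>

section \<open>Positive semidefinite kernels\<close>

definition psd_on :: "'a set \<Rightarrow> ('a \<Rightarrow> 'a \<Rightarrow> real) \<Rightarrow> bool" where
  "psd_on S K \<longleftrightarrow> (\<forall>x\<in>S. \<forall>y\<in>S. K x y = K y x) \<and>
     (\<forall>c. 0 \<le> (\<Sum>x\<in>S. \<Sum>y\<in>S. c x * c y * K x y))"

lemma psd_onI:
  assumes "\<And>x y. x \<in> S \<Longrightarrow> y \<in> S \<Longrightarrow> K x y = K y x"
    and "\<And>c. 0 \<le> (\<Sum>x\<in>S. \<Sum>y\<in>S. c x * c y * K x y)"
  shows "psd_on S K"
  using assms by (simp add: psd_on_def)

lemma psd_on_sym: "psd_on S K \<Longrightarrow> x \<in> S \<Longrightarrow> y \<in> S \<Longrightarrow> K x y = K y x"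
  by (simp add: psd_on_def)

lemma psd_on_form: "psd_on S K \<Longrightarrow> 0 \<le> (\<Sum>x\<in>S. \<Sum>y\<in>S. c x * c y * K x y)"
  by (simp add: psd_on_def)

lemma psd_on_cong:
  assumes "\<And>x y. x \<in> S \<Longrightarrow> y \<in> S \<Longrightarrow> K x y = L x y"
  shows "psd_on S K \<longleftrightarrow> psd_on S L"
  using assms by (simp add: psd_on_def cong: sum.cong)

lemma psd_on_zero: "psd_on S (\<lambda>x y. 0)"
  by (simp add: psd_on_def)

lemma psd_on_add:
  assumes "psd_on S K" "psd_on S L"
  shows "psd_on S (\<lambda>x y. K x y + L x y)"
  using assms by (simp add: psd_on_def distrib_left sum.distrib)

lemma psd_on_scale:
  assumes "psd_on S K" "a \<ge> 0"
  shows "psd_on S (\<lambda>x y. a * K x y)"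
proof (rule psd_onI)
  fix c :: "'a \<Rightarrow> real"
  have "(\<Sum>x\<in>S. \<Sum>y\<in>S. c x * c y * (a * K x y)) = a * (\<Sum>x\<in>S. \<Sum>y\<in>S. c x * c y * K x y)"
    by (simp add: sum_distrib_left mult_ac)
  then show "0 \<le> (\<Sum>x\<in>S. \<Sum>y\<in>S. c x * c y * (a * K x y))"
    using assms(2) psd_on_form[OF assms(1), of c] by simp
qed (simp add: psd_on_sym[OF assms(1)])

lemma psd_on_rank1: "psd_on S (\<lambda>x y. g x * g y)"
proof (rule psd_onI)
  fix c :: "'a \<Rightarrow> real"
  have "(\<Sum>x\<in>S. \<Sum>y\<in>S. c x * c y * (g x * g y)) = (\<Sum>x\<in>S. c x * g x)\<^sup>2"
    by (simp add: power2_eq_square sum_product mult_ac)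
  then show "0 \<le> (\<Sum>x\<in>S. \<Sum>y\<in>S. c x * c y * (g x * g y))" by simp
qed simp

lemma psd_on_sum:
  assumes "\<And>i. i \<in> I \<Longrightarrow> psd_on S (K i)"
  shows "psd_on S (\<lambda>x y. \<Sum>i\<in>I. K i x y)"
  using assms
  by (induction I rule: infinite_finite_induct) (auto simp: psd_on_zero intro!: psd_on_add)

lemma psd_on_limit:
  assumes "\<And>n. psd_on S (K n)"
    and "\<And>x y. x \<in> S \<Longrightarrow> y \<in> S \<Longrightarrow> (\<lambda>n. K n x y) \<longlonglongrightarrow> L x y"
  shows "psd_on S L"
proof (rule psd_onI)
  fix x y assume "x \<in> S" "y \<in> S"
  moreover from this have "K n x y = K n y x" for n
    by (intro psd_on_sym[OF assms(1)])
  ultimately show "L x y = L y x"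
    using assms(2)[of x y] assms(2)[of y x] by (auto intro: LIMSEQ_unique)
next
  fix c :: "'a \<Rightarrow> real"
  have "(\<lambda>n. \<Sum>x\<in>S. \<Sum>y\<in>S. c x * c y * K n x y) \<longlonglongrightarrow> (\<Sum>x\<in>S. \<Sum>y\<in>S. c x * c y * L x y)"
    using assms(2) by (intro tendsto_intros)
  then show "0 \<le> (\<Sum>x\<in>S. \<Sum>y\<in>S. c x * c y * L x y)"
    by (rule LIMSEQ_le_const) (auto intro: psd_on_form[OF assms(1)])
qed

lemma psd_on_sums:
  assumes "\<And>n. psd_on S (K n)"
    and "\<And>x y. x \<in> S \<Longrightarrow> y \<in> S \<Longrightarrow> (\<lambda>n. K n x y) sums L x y"
  shows "psd_on S L"
proof (rule psd_on_limit)
  show "psd_on S (\<lambda>x y. \<Sum>i<n. K i x y)" for n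
    using assms(1) by (rule psd_on_sum)
  show "(\<lambda>n. \<Sum>i<n. K i x y) \<longlonglongrightarrow> L x y" if "x \<in> S" "y \<in> S" for x y
    using assms(2)[OF that] by (simp add: sums_def)
qed

lemma psd_on_subset:
  assumes "psd_on S K" "T \<subseteq> S" "finite S"
  shows "psd_on T K"
proof (rule psd_onI)
  fix c :: "'a \<Rightarrow> real"
  define c' where "c' x = (if x \<in> T then c x else 0)" for x
  have "(\<Sum>x\<in>S. \<Sum>y\<in>S. c' x * c' y * K x y) = (\<Sum>x\<in>T. \<Sum>y\<in>S. c' x * c' y * K x y)"
    using assms by (intro sum.mono_neutral_right) (auto simp: c'_def)
  also have "\<dots> = (\<Sum>x\<in>T. \<Sum>y\<in>T. c' x * c' y * K x y)"
    using assms by (intro sum.cong[OF refl] sum.mono_neutral_right) (auto simp: c'_def)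
  also have "\<dots> = (\<Sum>x\<in>T. \<Sum>y\<in>T. c x * c y * K x y)"
    by (intro sum.cong) (auto simp: c'_def)
  finally show "0 \<le> (\<Sum>x\<in>T. \<Sum>y\<in>T. c x * c y * K x y)"
    using psd_on_form[OF assms(1), of c'] by simp
qed (use assms(2) psd_on_sym[OF assms(1)] in blast)

lemma psd_on_diag:
  assumes "psd_on S K" "finite S" "x \<in> S"
  shows "0 \<le> K x x"
  using psd_on_form[OF psd_on_subset[OF assms(1) _ assms(2), of "{x}"], of "\<lambda>_. 1"] assms(3)
  by simp

text \<open>Evaluating the form on vectors supported on two points gives a nonnegative binary quadratic form, whose
discriminant cannot be positive.\<close>

lemma psd_on_Cauchy_Schwarz:
  assumes "psd_on S K" "finite S" "x \<in> S" "y \<in> S"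
  shows "(K x y)\<^sup>2 \<le> K x x * K y y"
proof (cases "x = y")
  case True
  then show ?thesis by (simp add: power2_eq_square)
next
  case False
  have sym: "K y x = K x y" using assms by (intro psd_on_sym[OF assms(1)])
  have form: "0 \<le> a\<^sup>2 * K x x + 2 * a * b * K x y + b\<^sup>2 * K y y" for a b :: real
    using psd_on_form[OF psd_on_subset[OF assms(1) _ assms(2), of "{x, y}"],
        of "\<lambda>z. if z = x then a else b"] assms(3,4) False
    by (simp add: sym power2_eq_square algebra_simps)
  have diag: "0 \<le> K x x" "0 \<le> K y y" by (intro psd_on_diag[OF assms(1,2)] assms)+
  show ?thesis
  proof (cases "K x x = 0")
    case True
    have "K x y = 0"
    proof (rule ccontr)
      assume ne: "K x y \<noteq> 0"
      show False
        using form[of "- (K y y + 1) / (2 * K x y)" 1] True ne by (simp add: field_simps)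
    qed
    then show ?thesis using True by simp
  next
    case pos: False
    have "0 \<le> K x x * (K x x * K y y - (K x y)\<^sup>2)"
      using form[of "- K x y" "K x x"] by (simp add: power2_eq_square algebra_simps)
    then show ?thesis using pos diag by (simp add: zero_le_mult_iff)
  qed
qed

text \<open>Cholesky factorization: the new point \<open>z\<close> receives a coordinate of its own, and the Schur complement
\<open>K x y - K x z * K y z / K z z\<close> on the old points is again positive semidefinite. If \<open>K z z = 0\<close>,
then the whole row of \<open>z\<close> vanishes by Cauchy--Schwarz, and the convention \<open>c / 0 = 0\<close> makes the same
formulas correct.\<close>

lemma psd_on_gram:
  assumes "finite S" "psd_on S K"
  shows "\<exists>f :: 'a \<Rightarrow> nat \<Rightarrow> real. (\<forall>x\<in>S. \<forall>i\<ge>card S. f x i = 0) \<and>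
           (\<forall>x\<in>S. \<forall>y\<in>S. K x y = (\<Sum>i<card S. f x i * f y i))"
  using assms
proof (induction S arbitrary: K rule: finite_induct)
  case empty
  then show ?case by simp
next
  case (insert z S)
  note K = \<open>psd_on (insert z S) K\<close>
  have fin: "finite (insert z S)" using insert.hyps by simp
  define K' where "K' x y = K x y - K x z * K y z / K z z" for x y
  have sym: "K x y = K y x" if "x \<in> insert z S" "y \<in> insert z S" for x y
    using K that by (rule psd_on_sym)
  have vanish: "K x z = 0" if "K z z = 0" "x \<in> insert z S" for x
    using psd_on_Cauchy_Schwarz[OF K fin that(2), of z] that(1) by simp
  have "psd_on S K'"
  proof (rule psd_onI)
    fix c :: "'a \<Rightarrow> real"
    define u where "u = (\<Sum>x\<in>S. c x * K x z)"
    define Q where "Q = (\<Sum>x\<in>S. \<Sum>y\<in>S. c x * c y * K x y)"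
    have "(\<Sum>x\<in>S. \<Sum>y\<in>S. c x * c y * K' x y)
        = Q - (\<Sum>x\<in>S. \<Sum>y\<in>S. (c x * K x z) * (c y * K y z)) / K z z"
      by (simp add: Q_def K'_def sum_subtractf sum_divide_distrib algebra_simps)
    also have "\<dots> = Q - u * u / K z z"
      by (simp add: u_def sum_product)
    finally have eq: "(\<Sum>x\<in>S. \<Sum>y\<in>S. c x * c y * K' x y) = Q - u * u / K z z" .
    \<comment> \<open>The coefficient of \<open>z\<close> that minimizes the form when the other coefficients are fixed.\<close>
    define a where "a = - u / K z z"
    define c' where "c' x = (if x = z then a else c x)" for x
    have c'S: "c' x = c x" if "x \<in> S" for x using that insert.hyps by (auto simp: c'_def)
    have "(\<Sum>x\<in>insert z S. \<Sum>y\<in>insert z S. c' x * c' y * K x y)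
      = a * a * K z z + (\<Sum>y\<in>S. a * c y * K z y) + (\<Sum>x\<in>S. c x * a * K x z) + Q"
      using insert.hyps by (simp add: c'S c'_def[of z] sum.distrib Q_def cong: sum.cong)
    also have "(\<Sum>y\<in>S. a * c y * K z y) = a * u"
      unfolding u_def sum_distrib_left by (intro sum.cong) (auto simp: sym)
    also have "(\<Sum>x\<in>S. c x * a * K x z) = a * u"
      unfolding u_def sum_distrib_left by (intro sum.cong) auto
    finally have "0 \<le> a * a * K z z + a * u + a * u + Q"
      using psd_on_form[OF K, of c'] by simp
    also have "\<dots> = Q - u * u / K z z"
      by (cases "K z z = 0") (simp_all add: a_def field_simps)
    finally show "0 \<le> (\<Sum>x\<in>S. \<Sum>y\<in>S. c x * c y * K' x y)" by (simp add: eq)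
  qed (simp add: K'_def sym mult.commute)
  from insert.IH[OF this] obtain f where f0: "\<And>x i. x \<in> S \<Longrightarrow> i \<ge> card S \<Longrightarrow> f x i = 0"
    and f: "\<And>x y. x \<in> S \<Longrightarrow> y \<in> S \<Longrightarrow> K' x y = (\<Sum>i<card S. f x i * f y i)"
    by blast
  define g where "g x i = (if i = card S then K x z / sqrt (K z z) else
      if x = z then 0 else f x i)" for x i
  have Kz: "0 \<le> K z z" using psd_on_diag[OF K fin] by simp
  have split: "(\<Sum>i<card (insert z S). g x i * g y i)
      = (\<Sum>i<card S. (if x = z then 0 else f x i) * (if y = z then 0 else f y i))
        + K x z * K y z / K z z" for x y
    using insert.hyps Kz by (simp add: g_def)
  have "K x y = (\<Sum>i<card (insert z S). g x i * g y i)"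
    if "x \<in> insert z S" "y \<in> insert z S" for x y
  proof (cases "x = z \<or> y = z")
    case True
    then have "(\<Sum>i<card S. (if x = z then 0 else f x i) * (if y = z then 0 else f y i)) = 0"
      by (intro sum.neutral) auto
    moreover have "K x z * K y z / K z z = K x y"
      using True that sym[of z y] vanish[of x] vanish[of y] by (cases "K z z = 0") auto
    ultimately show ?thesis unfolding split by simp
  next
    case False
    then have "K' x y = (\<Sum>i<card S. (if x = z then 0 else f x i) * (if y = z then 0 else f y i))"
      using f that by simp
    then show ?thesis unfolding split by (simp add: K'_def)
  qed
  moreover have "g x i = 0" if "x \<in> insert z S" "i \<ge> card (insert z S)" for x i
    using that insert.hyps f0 by (auto simp: g_def)
  ultimately show ?case by (intro exI[of _ g]) blast
qed

text \<open>The Schur product theorem: a Gram factorization writes \<open>K\<close> as a sum of rank-one kernels, and multiplying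
\<open>L\<close> by a rank-one kernel only rescales the coefficients of the form.\<close>

lemma psd_on_mult:
  assumes "finite S" "psd_on S K" "psd_on S L"
  shows "psd_on S (\<lambda>x y. K x y * L x y)"
proof -
  obtain f :: "'a \<Rightarrow> nat \<Rightarrow> real" where
    f: "\<And>x y. x \<in> S \<Longrightarrow> y \<in> S \<Longrightarrow> K x y = (\<Sum>i<card S. f x i * f y i)"
    using psd_on_gram[OF assms(1,2)] by blast
  have "psd_on S (\<lambda>x y. f x i * f y i * L x y)" for i
  proof (rule psd_onI)
    fix c :: "'a \<Rightarrow> real"
    show "0 \<le> (\<Sum>x\<in>S. \<Sum>y\<in>S. c x * c y * (f x i * f y i * L x y))"
      using psd_on_form[OF assms(3), of "\<lambda>x. c x * f x i"] by (simp add: mult_ac)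
  qed (simp add: psd_on_sym[OF assms(3)])
  then have "psd_on S (\<lambda>x y. \<Sum>i<card S. f x i * f y i * L x y)"
    by (rule psd_on_sum)
  moreover have "(\<Sum>i<card S. f x i * f y i * L x y) = K x y * L x y" if "x \<in> S" "y \<in> S" for x y
    using f[OF that] by (simp add: sum_distrib_right)
  ultimately show ?thesis
    using psd_on_cong[of S "\<lambda>x y. \<Sum>i<card S. f x i * f y i * L x y" "\<lambda>x y. K x y * L x y"]
    by blast
qed

lemma psd_on_power:
  assumes "finite S" "psd_on S K"
  shows "psd_on S (\<lambda>x y. K x y ^ k)"
proof (induction k)
  case 0
  show ?case using psd_on_rank1[of S "\<lambda>_. 1"] by simp
next
  case (Suc k)
  then show ?case using psd_on_mult[OF assms(1,2)] by simp
qed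

text \<open>Taking powers is monotone for the order in which \<open>K\<close> is below \<open>L\<close> if \<open>L - K\<close> is positive semidefinite.\<close>

lemma psd_on_power_diff:
  assumes "finite S" "psd_on S K" "psd_on S (\<lambda>x y. L x y - K x y)"
  shows "psd_on S (\<lambda>x y. L x y ^ k - K x y ^ k)"
proof (induction k)
  case 0
  show ?case by (simp add: psd_on_zero)
next
  case (Suc k)
  have L: "psd_on S L" using psd_on_add[OF assms(2,3)] by simp
  have "psd_on S (\<lambda>x y. L x y * (L x y ^ k - K x y ^ k) + (L x y - K x y) * K x y ^ k)"
    by (intro psd_on_add psd_on_mult assms L Suc psd_on_power)
  then show ?case by (simp add: algebra_simps)
qed

lemma sums_neg_ln_one_minus:
  assumes "\<bar>t\<bar> < 1"
  shows "(\<lambda>k. t ^ Suc k / real (Suc k)) sums (- ln (1 - t :: real))"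
proof -
  have "(\<lambda>k. t ^ k / real k) sums (- ln (1 - t))"
    using sums_minus[OF ln_series'[of "- t"]] assms by simp
  then show ?thesis by (subst sums_Suc_iff) simp
qed

text \<open>All coefficients of the series of \<open>- ln (1 - s)\<close> are positive, and omitting one term of it leaves a
series of the same kind. The first version is used to bound \<open>- ln (1 - K)\<close> from below by a power of \<open>K\<close>.\<close>

lemma psd_on_neg_ln_one_minus:
  assumes "finite S" "psd_on S K" "\<And>x y. x \<in> S \<Longrightarrow> y \<in> S \<Longrightarrow> \<bar>K x y\<bar> < 1"
  shows "psd_on S (\<lambda>x y. - ln (1 - K x y) - K x y ^ Suc k / real (Suc k))"
    and "psd_on S (\<lambda>x y. - ln (1 - K x y))"
proof -
  have summand: "psd_on S (\<lambda>x y. K x y ^ Suc i / real (Suc i))" for i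
    using psd_on_scale[OF psd_on_power[OF assms(1,2), of "Suc i"], of "1 / real (Suc i)"] by simp
  show "psd_on S (\<lambda>x y. - ln (1 - K x y) - K x y ^ Suc k / real (Suc k))"
  proof (rule psd_on_sums)
    show "psd_on S (\<lambda>x y. if i = k then 0 else K x y ^ Suc i / real (Suc i))" for i
      using summand[of i] by (cases "i = k") (auto simp: psd_on_zero)
    fix x y assume "x \<in> S" "y \<in> S"
    from sums_diff[OF sums_neg_ln_one_minus[OF assms(3)[OF this]]
        sums_single[of k "\<lambda>i. K x y ^ Suc i / real (Suc i)"]]
    show "(\<lambda>i. if i = k then 0 else K x y ^ Suc i / real (Suc i)) sums
        (- ln (1 - K x y) - K x y ^ Suc k / real (Suc k))"
      by (rule back_subst[where P = "\<lambda>f. f sums _"]) auto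
  qed
  from psd_on_add[OF this summand[of k]] show "psd_on S (\<lambda>x y. - ln (1 - K x y))" by simp
qed

lemma psd_on_inverse_one_minus:
  assumes "finite S" "psd_on S K" "\<And>x y. x \<in> S \<Longrightarrow> y \<in> S \<Longrightarrow> \<bar>K x y\<bar> < 1"
  shows "psd_on S (\<lambda>x y. 1 / (1 - K x y))"
proof (rule psd_on_sums)
  show "psd_on S (\<lambda>x y. K x y ^ k)" for k
    using assms(1,2) by (rule psd_on_power)
  show "(\<lambda>k. K x y ^ k) sums (1 / (1 - K x y))" if "x \<in> S" "y \<in> S" for x y
    using assms(3)[OF that] geometric_sums[of "K x y"] by simp
qed

text \<open>The fixed-point iteration for \<open>r = (q + r\<^sup>2) / 2\<close>, whose smaller root is \<open>1 - sqrt (1 - q)\<close>. Each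
step only adds, multiplies and scales by \<open>1 / 2\<close>, so it preserves positive semidefiniteness. This shows
that \<open>1 - sqrt (1 - q)\<close> is positive semidefinite without its binomial series, whose convergence at
\<open>q = 1\<close>, the value on the diagonal, would need a separate argument.\<close>

fun sqrt_iter :: "real \<Rightarrow> nat \<Rightarrow> real" where
  "sqrt_iter q 0 = 0"
| "sqrt_iter q (Suc n) = (q + (sqrt_iter q n)\<^sup>2) / 2"

lemma sqrt_iter_tendsto:
  assumes "0 \<le> q" "q \<le> 1"
  shows "sqrt_iter q \<longlonglongrightarrow> 1 - sqrt (1 - q)"
proof -
  define r where "r = 1 - sqrt (1 - q)"
  have r: "0 \<le> r" "r \<le> 1" and r_fix: "r = (q + r\<^sup>2) / 2"
    using assms by (auto simp: r_def power2_diff)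
  have bounds: "0 \<le> sqrt_iter q n \<and> sqrt_iter q n \<le> r" for n
  proof (induction n)
    case (Suc n)
    then have "(sqrt_iter q n)\<^sup>2 \<le> r\<^sup>2" by (intro power_mono) auto
    then show ?case using assms r_fix by simp
  qed (use r in simp)
  have "incseq (sqrt_iter q)"
  proof (rule incseq_SucI)
    fix n
    have "0 \<le> (r - sqrt_iter q n) * (2 - r - sqrt_iter q n)"
      using bounds[of n] r by (intro mult_nonneg_nonneg) auto
    then show "sqrt_iter q n \<le> sqrt_iter q (Suc n)"
      using r_fix by (simp add: power2_eq_square algebra_simps)
  qed
  then obtain l where l: "sqrt_iter q \<longlonglongrightarrow> l" "\<And>n. sqrt_iter q n \<le> l"
    using bounds incseq_convergent[of "sqrt_iter q" r] by blast
  have "(\<lambda>n. sqrt_iter q (Suc n)) \<longlonglongrightarrow> (q + l\<^sup>2) / 2"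
    using l(1) by (auto intro!: tendsto_intros)
  then have "l = (q + l\<^sup>2) / 2"
    using l(1) LIMSEQ_Suc LIMSEQ_unique by blast
  then have "(1 - l)\<^sup>2 = 1 - q" by (simp add: power2_eq_square algebra_simps)
  moreover have "l \<le> 1"
    using l(1) bounds r(2) by (intro LIMSEQ_le_const2[OF l(1)]) (meson order_trans)
  ultimately have "1 - l = sqrt (1 - q)"
    by (metis diff_ge_0_iff_ge real_sqrt_unique)
  then have "l = 1 - sqrt (1 - q)" by simp
  then show ?thesis using l(1) by simp
qed

lemma psd_on_one_minus_sqrt:
  assumes "finite S" "psd_on S K" "\<And>x y. x \<in> S \<Longrightarrow> y \<in> S \<Longrightarrow> 0 \<le> K x y \<and> K x y \<le> 1"
  shows "psd_on S (\<lambda>x y. 1 - sqrt (1 - K x y))"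
proof (rule psd_on_limit)
  show "psd_on S (\<lambda>x y. sqrt_iter (K x y) n)" for n :: nat
  proof (induction n)
    case (Suc n)
    have "psd_on S (\<lambda>x y. (1/2) * (K x y + (sqrt_iter (K x y) n)\<^sup>2))"
      by (intro psd_on_scale psd_on_add psd_on_power assms Suc) simp
    then show ?case by simp
  qed (simp add: psd_on_zero)
  show "(\<lambda>n. sqrt_iter (K x y) n) \<longlonglongrightarrow> 1 - sqrt (1 - K x y)" if "x \<in> S" "y \<in> S" for x y
    using sqrt_iter_tendsto assms(3)[OF that] by simp
qed

section \<open>Kernels of the form arcosh\<close>

text \<open>This is \<open>arcosh B = ln (B + sqrt (B\<^sup>2 - 1))\<close> with the factor \<open>2 * B\<close> taken out of the logarithm. What
remains is a function of \<open>1 / B\<^sup>2\<close> that is built from \<open>1 - sqrt (1 - s)\<close> and \<open>ln (1 - s)\<close>.\<close>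

lemma arcosh_eq_ln_add:
  fixes B :: real
  assumes "B \<ge> 1"
  shows "arcosh B = ln 2 + ln B + ln (1 - (1 - sqrt (1 - (1 / B)\<^sup>2)) / 2)"
proof -
  have "sqrt (B\<^sup>2 - 1) = B * sqrt (1 - (1 / B)\<^sup>2)"
  proof -
    have "B\<^sup>2 - 1 = B\<^sup>2 * (1 - (1 / B)\<^sup>2)" using assms by (simp add: field_simps)
    then show ?thesis using assms by (simp only: real_sqrt_mult) simp
  qed
  then have eq: "B + sqrt (B\<^sup>2 - 1) = 2 * B * (1 - (1 - sqrt (1 - (1 / B)\<^sup>2)) / 2)"
    by (simp add: field_simps)
  have "(1 / B)\<^sup>2 \<le> 1" using assms by (simp add: power_le_one)
  then have "0 < 1 - (1 - sqrt (1 - (1 / B)\<^sup>2)) / 2"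
    using real_sqrt_ge_zero[of "1 - (1 / B)\<^sup>2"] by argo
  then show ?thesis using assms unfolding arcosh_real_def[OF assms] eq by (simp add: ln_mult)
qed

text \<open>Each off-diagonal term is at least \<open>- \<delta> * ((c x)\<^sup>2 + (c y)\<^sup>2) / 2\<close>, and over all pairs these bounds
add up to exactly what a diagonal of \<open>card S * \<delta>\<close> contributes.\<close>

lemma psd_on_if_diagonal_dominant:
  assumes "finite S" "\<delta> \<ge> 0" "\<And>x y. x \<in> S \<Longrightarrow> y \<in> S \<Longrightarrow> K x y = K y x"
    and "\<And>x y. x \<in> S \<Longrightarrow> y \<in> S \<Longrightarrow> x \<noteq> y \<Longrightarrow> \<bar>K x y\<bar> \<le> \<delta>"
    and "\<And>x. x \<in> S \<Longrightarrow> K x x \<ge> real (card S) * \<delta>"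
  shows "psd_on S K"
proof (rule psd_onI)
  fix c :: "'a \<Rightarrow> real"
  define D where "D x y = (if x = y then real (card S) * \<delta> * (c x)\<^sup>2 else 0)
      - \<delta> * (((c x)\<^sup>2 + (c y)\<^sup>2) / 2)" for x y
  have "D x y \<le> c x * c y * K x y" if "x \<in> S" "y \<in> S" for x y
  proof (cases "x = y")
    case True
    have "real (card S) * \<delta> * (c x)\<^sup>2 \<le> K x x * (c x)\<^sup>2"
      using assms(5)[OF that(1)] by (intro mult_right_mono) auto
    moreover have "0 \<le> \<delta> * (c x)\<^sup>2" using assms(2) by simp
    ultimately show ?thesis using True by (simp add: D_def power2_eq_square mult_ac)
  next
    case False
    have "\<bar>c x * c y * K x y\<bar> = \<bar>c x * c y\<bar> * \<bar>K x y\<bar>" by (simp add: abs_mult)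
    also have "\<dots> \<le> ((c x)\<^sup>2 + (c y)\<^sup>2) / 2 * \<delta>"
    proof (intro mult_mono)
      show "\<bar>c x * c y\<bar> \<le> ((c x)\<^sup>2 + (c y)\<^sup>2) / 2"
        using sum_squares_bound[of "\<bar>c x\<bar>" "\<bar>c y\<bar>"] by (simp add: abs_mult)
    qed (use assms(4)[OF that False] in auto)
    finally show ?thesis using False by (simp add: D_def mult.commute)
  qed
  then have "(\<Sum>x\<in>S. \<Sum>y\<in>S. D x y) \<le> (\<Sum>x\<in>S. \<Sum>y\<in>S. c x * c y * K x y)"
    by (intro sum_mono)
  moreover have "(\<Sum>x\<in>S. \<Sum>y\<in>S. D x y) = 0"
  proof -
    have "(\<Sum>x\<in>S. \<Sum>y\<in>S. if x = y then real (card S) * \<delta> * (c x)\<^sup>2 else 0)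
        = real (card S) * \<delta> * (\<Sum>x\<in>S. (c x)\<^sup>2)"
      using assms(1) by (simp add: sum_distrib_left)
    moreover have "(\<Sum>x\<in>S. \<Sum>y\<in>S. \<delta> * (((c x)\<^sup>2 + (c y)\<^sup>2) / 2))
        = real (card S) * \<delta> * (\<Sum>x\<in>S. (c x)\<^sup>2)"
      by (simp add: sum.distrib add_divide_distrib sum_distrib_left[symmetric]
          sum_divide_distrib[symmetric] distrib_left)
    ultimately show ?thesis by (simp add: D_def sum_subtractf)
  qed
  ultimately show "0 \<le> (\<Sum>x\<in>S. \<Sum>y\<in>S. c x * c y * K x y)" by simp
qed (use assms(3) in blast)

text \<open>The entrywise powers of \<open>K\<close> converge to the identity matrix, so a high power still dominates half
of it. This is where strict positivity comes from.\<close>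

lemma psd_on_power_minus_diagonal:
  assumes "finite S" "\<And>x y. x \<in> S \<Longrightarrow> y \<in> S \<Longrightarrow> K x y = K y x"
    and "\<And>x. x \<in> S \<Longrightarrow> K x x = 1"
    and "\<And>x y. x \<in> S \<Longrightarrow> y \<in> S \<Longrightarrow> x \<noteq> y \<Longrightarrow> \<bar>K x y\<bar> < 1"
  shows "\<exists>k. psd_on S (\<lambda>x y. K x y ^ Suc k - (if x = y then 1 / 2 else 0))"
proof (cases "S = {}")
  case True
  then show ?thesis by (simp add: psd_on_def)
next
  case False
  define \<delta> where "\<delta> = 1 / (2 * real (card S))"
  have card: "real (card S) > 0" using False assms(1) by (simp add: card_gt_0_iff)
  then have \<delta>: "\<delta> > 0" "real (card S) * \<delta> = 1 / 2" by (auto simp: \<delta>_def)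
  have "\<forall>\<^sub>F k in sequentially. \<forall>x\<in>S. \<forall>y\<in>S. x \<noteq> y \<longrightarrow> \<bar>K x y ^ Suc k\<bar> < \<delta>"
  proof (intro eventually_ball_finite ballI assms(1))
    fix x y assume xy: "x \<in> S" "y \<in> S"
    show "\<forall>\<^sub>F k in sequentially. x \<noteq> y \<longrightarrow> \<bar>K x y ^ Suc k\<bar> < \<delta>"
    proof (cases "x = y")
      case False
      then have "(\<lambda>k. \<bar>K x y\<bar> ^ Suc k) \<longlonglongrightarrow> 0"
        using assms(4)[OF xy] by (intro LIMSEQ_Suc LIMSEQ_realpow_zero) auto
      from order_tendstoD(2)[OF this \<delta>(1)] show ?thesis
        by (auto simp: power_abs abs_mult elim: eventually_mono)
    qed simp
  qed
  then obtain k where k: "\<And>x y. x \<in> S \<Longrightarrow> y \<in> S \<Longrightarrow> x \<noteq> y \<Longrightarrow> \<bar>K x y ^ Suc k\<bar> < \<delta>"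
    unfolding eventually_sequentially by blast
  have "psd_on S (\<lambda>x y. K x y ^ Suc k - (if x = y then 1 / 2 else 0))"
  proof (rule psd_on_if_diagonal_dominant[of S \<delta>])
    show "\<bar>K x y ^ Suc k - (if x = y then 1 / 2 else 0)\<bar> \<le> \<delta>"
      if "x \<in> S" "y \<in> S" "x \<noteq> y" for x y
      using k[OF that] that(3) by simp
    show "K x y ^ Suc k - (if x = y then 1 / 2 else 0)
        = K y x ^ Suc k - (if y = x then 1 / 2 else 0)" if "x \<in> S" "y \<in> S" for x y
      using assms(2)[OF that] by auto
  qed (use assms \<delta> in auto)
  then show ?thesis by blast
qed

text \<open>The kernel \<open>w x * w y * (1 - t x y)\<close> is \<open>cosh d\<close> in the coordinates of the Klein model: \<open>t\<close> plays the
role of the euclidean inner product of points of the unit ball and \<open>w\<close> that of \<open>1 / sqrt (1 - t x x)\<close>.\<close>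

lemma psd_on_const_minus_half_arcosh:
  fixes t :: "'a \<Rightarrow> 'a \<Rightarrow> real" and w :: "'a \<Rightarrow> real"
  assumes fin: "finite S" and t: "psd_on S t" and w: "\<And>x. x \<in> S \<Longrightarrow> w x > 0"
    and diag: "\<And>x. x \<in> S \<Longrightarrow> (w x)\<^sup>2 * (1 - t x x) = 1"
    and off: "\<And>x y. x \<in> S \<Longrightarrow> y \<in> S \<Longrightarrow> x \<noteq> y \<Longrightarrow> w x * w y * (1 - t x y) > 1"
  shows "\<exists>\<rho>>0. psd_on S (\<lambda>x y. \<rho> - arcosh (w x * w y * (1 - t x y)) / 2)"
proof -
  define B where "B x y = w x * w y * (1 - t x y)" for x y
  define q where "q x y = (1 / B x y)\<^sup>2" for x y
  define r where "r x y = 1 - sqrt (1 - q x y)" for x y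
  define h where "h x y = - ln (1 - 1 / 2 * r x y)" for x y
  define l where "l x = ln (w x)" for x
  define \<kappa> where "\<kappa> x y = - ln (1 - t x y)" for x y
  have t_lt_1: "t x x < 1" if "x \<in> S" for x
  proof -
    have "0 < (w x)\<^sup>2 * (1 - t x x)" using diag[OF that] by simp
    then show ?thesis using w[OF that] by (simp add: zero_less_mult_iff)
  qed
  have abs_t: "\<bar>t x y\<bar> < 1" if "x \<in> S" "y \<in> S" for x y
  proof -
    have "(t x y)\<^sup>2 \<le> t x x * t y y"
      using t fin that by (rule psd_on_Cauchy_Schwarz)
    also have "\<dots> < 1"
      using t_lt_1 psd_on_diag[OF t fin] that
      by (metis mult_strict_mono' mult_1)
    finally show ?thesis by (simp add: abs_square_less_1)
  qed
  have B_diag: "B x x = 1" if "x \<in> S" for x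
    using diag[OF that] by (simp add: B_def power2_eq_square)
  have B_ge_1: "B x y \<ge> 1" if "x \<in> S" "y \<in> S" for x y
    using B_diag that off[OF that] by (cases "x = y") (auto simp: B_def)
  have q_bounds: "0 \<le> q x y" "q x y \<le> 1" if "x \<in> S" "y \<in> S" for x y
    using B_ge_1[OF that] by (auto simp: q_def power_le_one)
  have "psd_on S (\<lambda>x y. ((1 / w x) * (1 / w y) * (1 / (1 - t x y)))\<^sup>2)"
    by (intro psd_on_power psd_on_mult psd_on_rank1 psd_on_inverse_one_minus fin t abs_t)
  then have q_psd: "psd_on S q"
    by (rule back_subst[where P = "psd_on S"]) (auto simp: q_def B_def fun_eq_iff)
  have r_psd: "psd_on S r"
    using psd_on_one_minus_sqrt[OF fin q_psd] q_bounds by (simp add: r_def[abs_def])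
  have r_bounds: "0 \<le> r x y" "r x y \<le> 1" if "x \<in> S" "y \<in> S" for x y
    using q_bounds[OF that] by (auto simp: r_def)
  have r_half_psd: "psd_on S (\<lambda>x y. 1 / 2 * r x y)"
    using psd_on_scale[OF r_psd, of "1/2"] by simp
  have r_half_lt: "\<bar>1 / 2 * r x y\<bar> < 1" if "x \<in> S" "y \<in> S" for x y
    using r_bounds[OF that] by simp
  \<comment> \<open>The difference is \<open>r\<^sup>2 / 4\<close>, because \<open>r = (q + r\<^sup>2) / 2\<close>.\<close>
  have r_minus_q: "psd_on S (\<lambda>x y. 1 / 2 * r x y - 1 / 4 * q x y)"
  proof -
    have "psd_on S (\<lambda>x y. 1 / 4 * (r x y)\<^sup>2)"
      by (intro psd_on_scale psd_on_power fin r_psd) simp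
    moreover have "1 / 4 * (r x y)\<^sup>2 = 1 / 2 * r x y - 1 / 4 * q x y" if "x \<in> S" "y \<in> S" for x y
      using q_bounds[OF that] by (simp add: r_def power2_diff)
    ultimately show ?thesis
      using psd_on_cong[of S "\<lambda>x y. 1 / 4 * (r x y)\<^sup>2" "\<lambda>x y. 1 / 2 * r x y - 1 / 4 * q x y"]
      by blast
  qed
  have q_sym: "q x y = q y x" if "x \<in> S" "y \<in> S" for x y
    using q_psd that by (rule psd_on_sym)
  have "\<bar>q x y\<bar> < 1" if "x \<in> S" "y \<in> S" "x \<noteq> y" for x y
    using off[OF that] by (auto simp: q_def B_def[symmetric] power2_eq_square divide_simps
        intro: mult_less_cancel_left_pos less_1_mult)
  then obtain k where k: "psd_on S (\<lambda>x y. q x y ^ Suc k - (if x = y then 1 / 2 else 0))"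
    using psd_on_power_minus_diagonal[OF fin, of q] q_sym B_diag by (auto simp: q_def)
  \<comment> \<open>The series of \<open>h\<close> in \<open>r / 2\<close> has the coefficient \<open>1 / (k + 1)\<close> at the power \<open>k + 1\<close>, and
    \<open>r / 2\<close> dominates \<open>q / 4\<close>; hence \<open>h\<close> dominates \<open>a\<close> times that power of \<open>q\<close>.\<close>
  define a where "a = (1 / real (Suc k)) * (1 / 4) ^ Suc k"
  have a: "a > 0" by (simp add: a_def)
  have "psd_on S (\<lambda>x y. (h x y - (1 / 2 * r x y) ^ Suc k / real (Suc k))
      + 1 / real (Suc k) * ((1 / 2 * r x y) ^ Suc k - (1 / 4 * q x y) ^ Suc k)
      + a * (q x y ^ Suc k - (if x = y then 1 / 2 else 0)))"
    unfolding h_def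
    by (intro psd_on_add psd_on_neg_ln_one_minus psd_on_scale psd_on_power_diff fin r_half_psd
        r_half_lt r_minus_q k psd_on_scale[OF q_psd]) (use a in auto)
  moreover have "h x y - (1 / 2 * r x y) ^ Suc k / real (Suc k)
      + 1 / real (Suc k) * ((1 / 2 * r x y) ^ Suc k - (1 / 4 * q x y) ^ Suc k)
      + a * (q x y ^ Suc k - (if x = y then 1 / 2 else 0))
      = h x y - (if x = y then a / 2 else 0)" for x y
  proof -
    have "a * q x y ^ Suc k = 1 / real (Suc k) * (1 / 4 * q x y) ^ Suc k"
      by (simp only: a_def power_mult_distrib mult.assoc)
    then show ?thesis by (simp only: right_diff_distrib) simp
  qed
  ultimately have h_psd: "psd_on S (\<lambda>x y. h x y - (if x = y then a / 2 else 0))"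
    by (simp only:)
  have \<kappa>_psd: "psd_on S \<kappa>"
    using psd_on_neg_ln_one_minus(2)[OF fin t abs_t] by (simp add: \<kappa>_def[abs_def])
  define e where "e = a / 4"
  \<comment> \<open>For coefficients \<open>c\<close> with sum \<open>s\<close>, the kernel below gives
    \<open>\<Lambda> * s\<^sup>2 - s * (\<Sum>x\<in>S. c x * l x) + e * (\<Sum>x\<in>S. (c x)\<^sup>2)\<close>. This \<open>\<Lambda>\<close> completes the square: up to the
    factor \<open>4 * e\<close> the form is the sum of the squares of \<open>s * l x - 2 * e * c x\<close>.\<close>
  define \<Lambda> where "\<Lambda> = (\<Sum>x\<in>S. (l x)\<^sup>2) / (4 * e)"
  have e: "e > 0" using a by (simp add: e_def)
  have "psd_on S (\<lambda>x y. \<Lambda> - (l x + l y) / 2 + (if x = y then e else 0))"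
  proof (rule psd_onI)
    fix c :: "'a \<Rightarrow> real"
    define s where "s = (\<Sum>x\<in>S. c x)"
    define u where "u = (\<Sum>x\<in>S. c x * l x)"
    define C where "C = (\<Sum>x\<in>S. (c x)\<^sup>2)"
    have eq: "c x * c y * (\<Lambda> - (l x + l y) / 2 + (if x = y then e else 0))
        = \<Lambda> * (c x * c y) + - 1 / 2 * ((c x * l x) * c y) + - 1 / 2 * (c x * (c y * l y))
          + (if x = y then e * (c x)\<^sup>2 else 0)" for x y
      by (auto simp: power2_eq_square algebra_simps add_divide_distrib)
    have "(\<Sum>x\<in>S. \<Sum>y\<in>S. c x * c y * (\<Lambda> - (l x + l y) / 2 + (if x = y then e else 0)))
        = \<Lambda> * (s * s) + - 1 / 2 * (u * s) + - 1 / 2 * (s * u) + e * C"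
      unfolding eq s_def u_def C_def
      by (simp only: sum.distrib sum_distrib_left[symmetric] sum_distrib_right[symmetric])
        (simp add: fin sum_distrib_left)
    also have "\<dots> = (s\<^sup>2 * (\<Lambda> * (4 * e)) - 4 * e * s * u + 4 * e\<^sup>2 * C) / (4 * e)"
      using e by (simp add: power2_eq_square field_simps)
    also have "s\<^sup>2 * (\<Lambda> * (4 * e)) - 4 * e * s * u + 4 * e\<^sup>2 * C
        = (\<Sum>x\<in>S. (s * l x - 2 * e * c x)\<^sup>2)"
    proof -
      have "\<Lambda> * (4 * e) = (\<Sum>x\<in>S. (l x)\<^sup>2)" using e by (simp add: \<Lambda>_def)
      moreover have "(s * l x - 2 * e * c x)\<^sup>2
          = s\<^sup>2 * (l x)\<^sup>2 - 4 * e * s * (c x * l x) + 4 * e\<^sup>2 * (c x)\<^sup>2" for x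
        by (simp add: power2_eq_square algebra_simps)
      ultimately show ?thesis
        by (simp only: u_def C_def sum_distrib_left sum.distrib sum_subtractf)
    qed
    finally show "0 \<le> (\<Sum>x\<in>S. \<Sum>y\<in>S. c x * c y * (\<Lambda> - (l x + l y) / 2 + (if x = y then e else 0)))"
      using e by (simp add: sum_nonneg)
  qed simp
  from psd_on_add[OF psd_on_add[OF psd_on_scale[OF \<kappa>_psd, of "1 / 2"]
        psd_on_scale[OF h_psd, of "1 / 2"]] this]
  have "psd_on S (\<lambda>x y. 1 / 2 * \<kappa> x y + 1 / 2 * (h x y - (if x = y then a / 2 else 0))
      + (\<Lambda> - (l x + l y) / 2 + (if x = y then e else 0)))"
    by simp
  moreover have "1 / 2 * \<kappa> x y + 1 / 2 * (h x y - (if x = y then a / 2 else 0))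
      + (\<Lambda> - (l x + l y) / 2 + (if x = y then e else 0)) = (\<Lambda> + ln 2 / 2) - arcosh (B x y) / 2"
    if "x \<in> S" "y \<in> S" for x y
  proof -
    have "ln (B x y) = l x + l y - \<kappa> x y"
      using w[OF that(1)] w[OF that(2)] abs_t[OF that]
      by (simp add: B_def l_def \<kappa>_def ln_mult_pos)
    then have "arcosh (B x y) = ln 2 + (l x + l y - \<kappa> x y) - h x y"
      using arcosh_eq_ln_add[OF B_ge_1[OF that]] by (simp add: h_def r_def q_def)
    then show ?thesis by (cases "x = y") (simp_all add: e_def add_divide_distrib diff_divide_distrib)
  qed
  ultimately have "psd_on S (\<lambda>x y. (\<Lambda> + ln 2 / 2) - arcosh (B x y) / 2)"
    using psd_on_cong[of S "\<lambda>x y. 1 / 2 * \<kappa> x y + 1 / 2 * (h x y - (if x = y then a / 2 else 0))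
      + (\<Lambda> - (l x + l y) / 2 + (if x = y then e else 0))"
      "\<lambda>x y. (\<Lambda> + ln 2 / 2) - arcosh (B x y) / 2"] by blast
  moreover have "\<Lambda> + ln 2 / 2 > 0"
    using e by (simp add: \<Lambda>_def add_nonneg_pos sum_nonneg)
  ultimately show ?thesis unfolding B_def by blast
qed

section \<open>The hyperboloid model\<close>

lemma lorentz_commute: "lorentz n x y = lorentz n y x"
  by (simp add: lorentz_def mult.commute)

lemma lorentz_sum_left:
  "lorentz n (\<lambda>i. \<Sum>x\<in>S. c x * v x i) w = (\<Sum>x\<in>S. c x * lorentz n (v x) w)"
proof -
  have "(\<Sum>i = 1..n. (\<Sum>x\<in>S. c x * v x i) * w i) = (\<Sum>x\<in>S. c x * (\<Sum>i = 1..n. v x i * w i))"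
    unfolding sum_distrib_left sum_distrib_right by (subst sum.swap) (simp add: mult.assoc)
  then show ?thesis
    by (simp add: lorentz_def distrib_left sum.distrib sum_subtractf sum_distrib_right
        right_diff_distrib mult.assoc)
qed

text \<open>For \<open>lorentz n y y = - 1\<close> this kernel is the Lorentz form after orthogonal projection along \<open>y\<close>. Its
value at a combination \<open>z\<close> is \<open>lorentz n z z + (lorentz n z y)\<^sup>2\<close>, which can only be negative for a
negative \<open>z\<close>, and then the reverse Cauchy--Schwarz inequality applies.\<close>

lemma psd_on_lorentz_complement:
  assumes "lorentz n y y = - 1"
  shows "psd_on S (\<lambda>u v. lorentz n (f u) (f v) + lorentz n (f u) y * lorentz n (f v) y)"
proof (rule psd_onI)
  fix c :: "'a \<Rightarrow> real"
  define z where "z = (\<lambda>i. \<Sum>u\<in>S. c u * f u i)"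
  have zy: "lorentz n z y = (\<Sum>u\<in>S. c u * lorentz n (f u) y)"
    unfolding z_def by (rule lorentz_sum_left)
  have "lorentz n z z = (\<Sum>u\<in>S. c u * lorentz n z (f u))"
    by (subst (2) z_def) (subst lorentz_commute, simp add: lorentz_sum_left lorentz_commute[of n z])
  also have "\<dots> = (\<Sum>u\<in>S. \<Sum>v\<in>S. c u * c v * lorentz n (f u) (f v))"
    by (simp add: z_def lorentz_sum_left sum_distrib_left mult.assoc lorentz_commute)
  finally have "(\<Sum>u\<in>S. \<Sum>v\<in>S. c u * c v *
      (lorentz n (f u) (f v) + lorentz n (f u) y * lorentz n (f v) y))
      = lorentz n z z + (lorentz n z y)\<^sup>2"
    by (simp add: zy power2_eq_square sum_product distrib_left sum.distrib mult_ac)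
  moreover have "0 \<le> lorentz n z z + (lorentz n z y)\<^sup>2"
    using reverse_Cauchy_Schwarz[of n z y] assms by (cases "lorentz n z z < 0") auto
  ultimately show "0 \<le> (\<Sum>u\<in>S. \<Sum>v\<in>S. c u * c v *
      (lorentz n (f u) (f v) + lorentz n (f u) y * lorentz n (f v) y))" by simp
qed (simp add: lorentz_commute mult.commute)

definition hyperboloid :: "nat \<Rightarrow> (nat \<Rightarrow> real) set" where
  "hyperboloid n = {x \<in> topspace (Euclidean_space (Suc n)). lorentz n x x = - 1 \<and> x 0 > 0}"

lemma hyperboloidD:
  assumes "x \<in> hyperboloid n"
  shows "lorentz n x x = - 1" "x 0 > 0" "(\<Sum>i = 1..n. (x i)\<^sup>2) = (x 0)\<^sup>2 - 1"
  using assms by (auto simp: hyperboloid_def lorentz_def power2_eq_square)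

lemma proj_class_scale:
  assumes "a \<noteq> 0"
  shows "proj_class (\<lambda>i. a * y i) = proj_class y"
proof (intro subset_antisym subsetI)
  fix z assume "z \<in> proj_class (\<lambda>i. a * y i)"
  then obtain c where "z = (\<lambda>i. (c * a) * y i)" "c * a \<noteq> 0"
    unfolding proj_class_def using assms by (auto simp: mult.assoc)
  then show "z \<in> proj_class y" unfolding proj_class_def by blast
next
  fix z assume "z \<in> proj_class y"
  then obtain c where "z = (\<lambda>i. (c / a) * (a * y i))" "c / a \<noteq> 0"
    unfolding proj_class_def using assms by auto
  then show "z \<in> proj_class (\<lambda>i. a * y i)" unfolding proj_class_def by blast
qed

lemma hyp_space_representative:
  assumes "X \<in> hyp_space n"
  shows "\<exists>x\<in>hyperboloid n. X = proj_class x"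
proof -
  obtain y where y: "y \<in> topspace (Euclidean_space (Suc n))" "lorentz n y y < 0" "X = proj_class y"
    using assms by (auto simp: hyp_space_def)
  have y0: "y 0 \<noteq> 0"
    using y(2) sum_nonneg[of "{1..n}" "\<lambda>i. y i * y i"] by (auto simp: lorentz_def)
  define a where "a = sgn (y 0) / sqrt (- lorentz n y y)"
  have a: "a \<noteq> 0" "a * y 0 > 0" "a * a * lorentz n y y = - 1"
    using y(2) y0 by (auto simp: a_def sgn_if field_simps zero_less_mult_iff)
  define x where "x = (\<lambda>i. a * y i)"
  have "x \<in> hyperboloid n"
    using y(1) a unfolding hyperboloid_def x_def by (simp add: lorentz_scale topspace_Euclidean_space)
  moreover have "proj_class y = proj_class x"
    unfolding x_def using proj_class_scale[OF a(1)] by simp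
  ultimately show ?thesis using y(3) by blast
qed

lemma lorentz_hyperboloid_le:
  assumes "x \<in> hyperboloid n" "y \<in> hyperboloid n"
  shows "lorentz n x y \<le> - 1"
proof -
  note x = hyperboloidD[OF assms(1)] and y = hyperboloidD[OF assms(2)]
  define C where "C = (\<Sum>i = 1..n. x i * y i)"
  have "C\<^sup>2 \<le> ((x 0)\<^sup>2 - 1) * ((y 0)\<^sup>2 - 1)"
    unfolding C_def x(3)[symmetric] y(3)[symmetric] by (rule Cauchy_Schwarz_ineq_sum)
  also have "\<dots> \<le> (x 0)\<^sup>2 * (y 0)\<^sup>2"
  proof (rule mult_mono)
    have "0 \<le> (\<Sum>i = 1..n. (y i)\<^sup>2)" by (intro sum_nonneg) auto
    then show "0 \<le> (y 0)\<^sup>2 - 1" by (simp only: y(3))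
  qed auto
  finally have "C \<le> x 0 * y 0"
    using x(2) y(2) by (simp add: abs_le_square_iff[symmetric] flip: power_mult_distrib)
  then have "lorentz n x y \<le> 0" by (simp add: lorentz_def C_def)
  moreover have "1 \<le> (lorentz n x y)\<^sup>2"
    using reverse_Cauchy_Schwarz[of n x y] x(1) y(1) by simp
  ultimately show ?thesis
    using abs_le_square_iff[of 1 "lorentz n x y"] by simp
qed

lemma hyp_dist_hyperboloid:
  assumes "x \<in> hyperboloid n" "y \<in> hyperboloid n"
  shows "hyp_dist n (proj_class x) (proj_class y) = arcosh (- lorentz n x y)"
  using hyperboloidD(1)[OF assms(1)] hyperboloidD(1)[OF assms(2)] lorentz_hyperboloid_le[OF assms]
  by (simp add: hyp_dist_proj_class)

text \<open>If \<open>lorentz n x y = - 1\<close>, then \<open>v = x - y\<close> is a null vector orthogonal to the negative vector \<open>y\<close>. Such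
a vector is zero, as the form is positive definite on the orthogonal complement of \<open>y\<close>.\<close>

lemma hyperboloid_eqI:
  assumes "x \<in> hyperboloid n" "y \<in> hyperboloid n" "lorentz n x y = - 1"
  shows "x = y"
proof -
  note x = hyperboloidD[OF assms(1)] and y = hyperboloidD[OF assms(2)]
  define v where "v i = x i - y i" for i
  define A where "A = (\<Sum>i = 1..n. (v i)\<^sup>2)"
  define C where "C = (\<Sum>i = 1..n. v i * y i)"
  have "lorentz n v v = lorentz n x x - 2 * lorentz n x y + lorentz n y y"
    by (simp add: lorentz_def v_def sum.distrib sum_subtractf sum_distrib_left algebra_simps)
  then have A: "A = (v 0)\<^sup>2"
    using x(1) y(1) assms(3) by (simp add: lorentz_def A_def power2_eq_square)
  have "lorentz n v y = lorentz n x y - lorentz n y y"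
    by (simp add: lorentz_def v_def sum.distrib sum_subtractf algebra_simps)
  then have C: "C = v 0 * y 0"
    using y(1) assms(3) by (simp add: lorentz_def C_def)
  have "C\<^sup>2 \<le> A * ((y 0)\<^sup>2 - 1)"
    unfolding A_def C_def y(3)[symmetric] by (rule Cauchy_Schwarz_ineq_sum)
  then have v0: "v 0 = 0" by (simp add: A C power_mult_distrib algebra_simps)
  then have "(\<Sum>i = 1..n. (v i)\<^sup>2) = 0" using A by (simp add: A_def)
  then have "\<forall>i\<in>{1..n}. v i = 0" by (simp add: sum_nonneg_eq_0_iff)
  then have "v i = 0" for i
    using v0 assms(1,2)
    by (cases "i = 0"; cases "i \<le> n") (auto simp: v_def hyperboloid_def topspace_Euclidean_space)
  then show ?thesis by (auto simp: v_def fun_eq_iff)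
qed

lemma hyp_dist_nonneg:
  assumes "X \<in> hyp_space n" "Y \<in> hyp_space n"
  shows "0 \<le> hyp_dist n X Y"
  using assms cosh_hyp_dist(2) by (auto simp: hyp_space_def)

lemma hyp_dist_commute:
  assumes "X \<in> hyp_space n" "Y \<in> hyp_space n"
  shows "hyp_dist n X Y = hyp_dist n Y X"
  using hyp_space_representative[OF assms(1)] hyp_space_representative[OF assms(2)]
  by (auto simp: hyp_dist_hyperboloid lorentz_commute)

lemma hyp_dist_pos:
  assumes "X \<in> hyp_space n" "Y \<in> hyp_space n" "X \<noteq> Y"
  shows "0 < hyp_dist n X Y"
proof -
  obtain x y where xy: "x \<in> hyperboloid n" "y \<in> hyperboloid n" "X = proj_class x" "Y = proj_class y"
    using hyp_space_representative assms by meson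
  have "- lorentz n x y > 1"
    using lorentz_hyperboloid_le[OF xy(1,2)] hyperboloid_eqI[OF xy(1,2)] assms(3) xy(3,4) by force
  then show ?thesis using xy by (simp add: hyp_dist_hyperboloid)
qed

text \<open>Cauchy--Schwarz for the components of \<open>x\<close> and \<open>z\<close> orthogonal to \<open>y\<close>, whose squared lengths are
\<open>(sinh d)\<^sup>2\<close> and \<open>(sinh e)\<^sup>2\<close>, compares \<open>cosh (hyp_dist n X Z)\<close> with
\<open>cosh d * cosh e + sinh d * sinh e = cosh (d + e)\<close>.\<close>

lemma hyp_dist_triangle:
  assumes "X \<in> hyp_space n" "Y \<in> hyp_space n" "Z \<in> hyp_space n"
  shows "hyp_dist n X Z \<le> hyp_dist n X Y + hyp_dist n Y Z"
proof (rule ccontr)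
  assume contra: "\<not> ?thesis"
  obtain x y z where x: "x \<in> hyperboloid n" "X = proj_class x"
    and y: "y \<in> hyperboloid n" "Y = proj_class y" and z: "z \<in> hyperboloid n" "Z = proj_class z"
    using hyp_space_representative assms by meson
  note norm = hyperboloidD(1)[OF x(1)] hyperboloidD(1)[OF y(1)] hyperboloidD(1)[OF z(1)]
  define d where "d = hyp_dist n X Y"
  define e where "e = hyp_dist n Y Z"
  have cosh: "cosh d = - lorentz n x y" "cosh e = - lorentz n z y"
    "cosh (hyp_dist n X Z) = - lorentz n x z"
    using lorentz_hyperboloid_le[OF x(1) y(1)] lorentz_hyperboloid_le[OF z(1) y(1)]
      lorentz_hyperboloid_le[OF x(1) z(1)]
      hyp_dist_hyperboloid[OF x(1) y(1)] hyp_dist_hyperboloid[OF y(1) z(1)]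
      hyp_dist_hyperboloid[OF x(1) z(1)]
    by (simp_all add: d_def e_def x(2) y(2) z(2) lorentz_commute[of n y z])
  have nonneg: "0 \<le> d" "0 \<le> e"
    using assms hyp_dist_nonneg by (simp_all add: d_def e_def)
  have "(lorentz n x z + cosh d * cosh e)\<^sup>2 \<le> ((cosh d)\<^sup>2 - 1) * ((cosh e)\<^sup>2 - 1)"
    using psd_on_Cauchy_Schwarz[OF psd_on_lorentz_complement[OF norm(2), of "{x, z}" "\<lambda>u. u"], of x z]
    by (simp add: cosh norm power2_eq_square)
  also have "\<dots> = (sinh d * sinh e)\<^sup>2"
    by (simp add: sinh_square_eq power_mult_distrib)
  finally have "\<bar>lorentz n x z + cosh d * cosh e\<bar> \<le> sinh d * sinh e"
    using nonneg by (simp add: abs_le_square_iff[symmetric])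
  then have "cosh (hyp_dist n X Z) \<le> cosh (d + e)"
    by (simp add: cosh(3) cosh_add)
  moreover have "cosh (d + e) < cosh (hyp_dist n X Z)"
    using contra nonneg by (intro cosh_real_strict_mono) (auto simp: d_def e_def)
  ultimately show False by simp
qed

lemma psd_on_const_minus_half_hyp_dist:
  assumes "finite S" "S \<subseteq> hyp_space n"
  shows "\<exists>\<rho>>0. psd_on S (\<lambda>X Y. \<rho> - hyp_dist n X Y / 2)"
proof -
  define v where "v X = (SOME x. x \<in> hyperboloid n \<and> X = proj_class x)" for X
  have "v X \<in> hyperboloid n \<and> X = proj_class (v X)" if "X \<in> S" for X
    unfolding v_def using hyp_space_representative[of X n] that assms(2)
    by (intro someI_ex[of "\<lambda>x. x \<in> hyperboloid n \<and> X = proj_class x"]) blast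
  then have v: "v X \<in> hyperboloid n" and X: "X = proj_class (v X)" if "X \<in> S" for X
    using that by blast+
  \<comment> \<open>The inner product in the Klein model, where \<open>v X\<close> is rescaled to have time coordinate \<open>1\<close>.\<close>
  define t where "t X Y = (\<Sum>i = 1..n. (v X i / v X 0) * (v Y i / v Y 0))" for X Y
  have eq: "v X 0 * v Y 0 * (1 - t X Y) = - lorentz n (v X) (v Y)" if "X \<in> S" "Y \<in> S" for X Y
  proof -
    have "v X 0 * v Y 0 * t X Y = (\<Sum>i = 1..n. v X i * v Y i)"
      unfolding t_def sum_distrib_left
      using hyperboloidD(2)[OF v[OF that(1)]] hyperboloidD(2)[OF v[OF that(2)]]
      by (intro sum.cong) (auto simp: field_simps)
    then show ?thesis by (simp add: lorentz_def right_diff_distrib)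
  qed
  have "\<exists>\<rho>>0. psd_on S (\<lambda>X Y. \<rho> - arcosh (v X 0 * v Y 0 * (1 - t X Y)) / 2)"
  proof (rule psd_on_const_minus_half_arcosh[OF assms(1)])
    show "psd_on S t" unfolding t_def by (intro psd_on_sum psd_on_rank1)
    show "v X 0 > 0" if "X \<in> S" for X using hyperboloidD(2)[OF v[OF that]] .
    show "(v X 0)\<^sup>2 * (1 - t X X) = 1" if "X \<in> S" for X
      using eq[OF that that] hyperboloidD(1)[OF v[OF that]] by (simp add: power2_eq_square)
    show "v X 0 * v Y 0 * (1 - t X Y) > 1" if "X \<in> S" "Y \<in> S" "X \<noteq> Y" for X Y
    proof -
      have "v X \<noteq> v Y" using X that by metis
      then have "lorentz n (v X) (v Y) \<noteq> - 1" using hyperboloid_eqI v that by blast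
      then show ?thesis
        using lorentz_hyperboloid_le[OF v[OF that(1)] v[OF that(2)]] eq[OF that(1,2)] by simp
    qed
  qed
  moreover have "arcosh (v X 0 * v Y 0 * (1 - t X Y)) = hyp_dist n X Y"
    if "X \<in> S" "Y \<in> S" for X Y
    using eq[OF that] hyp_dist_hyperboloid[OF v[OF that(1)] v[OF that(2)]] X[OF that(1)] X[OF that(2)]
    by simp
  ultimately show ?thesis
    by (auto simp: psd_on_def cong: sum.cong)
qed

section \<open>Points spanning no obtuse angle\<close>

definition dot :: "nat \<Rightarrow> (nat \<Rightarrow> real) \<Rightarrow> (nat \<Rightarrow> real) \<Rightarrow> real" where
  "dot p u v = (\<Sum>i<p. u i * v i)"

definition no_obtuse_angle :: "nat \<Rightarrow> 'a set \<Rightarrow> ('a \<Rightarrow> nat \<Rightarrow> real) \<Rightarrow> bool" where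
  "no_obtuse_angle p S f \<longleftrightarrow> (\<forall>x\<in>S. \<forall>y\<in>S. \<forall>z\<in>S.
     0 \<le> dot p (\<lambda>i. f z i - f x i) (\<lambda>i. f y i - f x i))"

lemma dot_sum_left: "dot p (\<lambda>i. \<Sum>k\<in>A. c k * g k i) u = (\<Sum>k\<in>A. c k * dot p (g k) u)"
  unfolding dot_def sum_distrib_left sum_distrib_right by (subst sum.swap) (simp add: mult.assoc)

text \<open>The angles at \<open>x\<close> and \<open>y\<close> confine all points to the slab between the hyperplanes through \<open>x\<close> and
\<open>y\<close> orthogonal to \<open>f y - f x\<close>. Any two points \<open>a\<close>, \<open>b\<close> therefore differ in this direction by at most
the width of the slab.\<close>

lemma no_obtuse_angle_slab:
  assumes "no_obtuse_angle p S f" "x \<in> S" "y \<in> S" "a \<in> S" "b \<in> S"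
  shows "- dot p (\<lambda>i. f y i - f x i) (\<lambda>i. f y i - f x i)
    \<le> dot p (\<lambda>i. f b i - f a i) (\<lambda>i. f y i - f x i)"
proof -
  have "0 \<le> dot p (\<lambda>i. f b i - f x i) (\<lambda>i. f y i - f x i)"
    "0 \<le> dot p (\<lambda>i. f a i - f y i) (\<lambda>i. f x i - f y i)"
    using assms unfolding no_obtuse_angle_def by blast+
  then have "0 \<le> dot p (\<lambda>i. f b i - f x i) (\<lambda>i. f y i - f x i)
      + dot p (\<lambda>i. f a i - f y i) (\<lambda>i. f x i - f y i)" by simp
  also have "\<dots> = dot p (\<lambda>i. f b i - f a i) (\<lambda>i. f y i - f x i)
      + dot p (\<lambda>i. f y i - f x i) (\<lambda>i. f y i - f x i)"
    unfolding dot_def sum.distrib[symmetric] by (intro sum.cong) (auto simp: algebra_simps)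
  finally show ?thesis by simp
qed

text \<open>Let \<open>N\<close> be the largest position at which the words differ, and look in the direction from \<open>f (a N)\<close> to
\<open>f (b N)\<close>. Position \<open>N\<close> contributes \<open>2 ^ N\<close> times the squared distance of the two points, while the
smaller positions together can take back at most \<open>2 ^ N - 1\<close> times this amount, by the slab property.\<close>

lemma dyadic_sums_separated:
  assumes "no_obtuse_angle p S f" "a \<in> {..<N} \<rightarrow> S" "b \<in> {..<N} \<rightarrow> S" "\<exists>k<N. a k \<noteq> b k"
  shows "\<exists>x\<in>S. \<exists>y\<in>S. x \<noteq> y \<and>
    dot p (\<lambda>i. f y i - f x i) (\<lambda>i. f y i - f x i) \<le>
    dot p (\<lambda>i. \<Sum>k<N. 2 ^ k * (f (b k) i - f (a k) i)) (\<lambda>i. f y i - f x i)"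
  using assms(2-)
proof (induction N)
  case 0
  then show ?case by simp
next
  case (Suc N)
  show ?case
  proof (cases "a N = b N")
    case True
    with Suc.prems(3) have "\<exists>k<N. a k \<noteq> b k" using less_Suc_eq by blast
    moreover have "a \<in> {..<N} \<rightarrow> S" "b \<in> {..<N} \<rightarrow> S" using Suc.prems(1,2) by auto
    ultimately show ?thesis using Suc.IH True by simp
  next
    case False
    have S: "a k \<in> S" "b k \<in> S" if "k \<le> N" for k using Suc.prems(1,2) that by auto
    define u where "u = (\<lambda>i. f (b N) i - f (a N) i)"
    define d where "d k = dot p (\<lambda>i. f (b k) i - f (a k) i) u" for k
    have "- d N \<le> d k" if "k < N" for k
      using no_obtuse_angle_slab[OF assms(1) S(1)[of N] S(2)[of N] S(1)[of k] S(2)[of k]] that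
      by (simp add: d_def u_def)
    then have "(\<Sum>k<N. 2 ^ k * - d N) \<le> (\<Sum>k<N. 2 ^ k * d k)"
      by (intro sum_mono mult_left_mono) auto
    also have "(\<Sum>k<N. 2 ^ k * - d N) = (2 ^ N - 1) * - d N"
      unfolding sum_distrib_right[symmetric] by (simp add: geometric_sum)
    finally have "d N \<le> (\<Sum>k<Suc N. 2 ^ k * d k)" by (simp add: algebra_simps)
    then show ?thesis
      unfolding d_def u_def dot_sum_left using False S[of N] by blast
  qed
qed

lemma exists_separating_mesh:
  assumes "finite S"
    and "\<And>x y. x \<in> S \<Longrightarrow> y \<in> S \<Longrightarrow> x \<noteq> y \<Longrightarrow> 0 < dot p (\<lambda>i. f y i - f x i) (\<lambda>i. f y i - f x i)"
  shows "\<exists>\<epsilon>>0. \<forall>x\<in>S. \<forall>y\<in>S. x \<noteq> y \<longrightarrow>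
    \<epsilon> * (\<Sum>i<p. \<bar>f y i - f x i\<bar>) < dot p (\<lambda>i. f y i - f x i) (\<lambda>i. f y i - f x i)"
proof -
  have "\<forall>\<^sub>F \<epsilon> in at_right 0. \<forall>x\<in>S. \<forall>y\<in>S. x \<noteq> y \<longrightarrow>
    \<epsilon> * (\<Sum>i<p. \<bar>f y i - f x i\<bar>) < dot p (\<lambda>i. f y i - f x i) (\<lambda>i. f y i - f x i)"
  proof (intro eventually_ball_finite ballI assms(1))
    fix x y assume xy: "x \<in> S" "y \<in> S"
    have lim: "((\<lambda>\<epsilon>. \<epsilon> * (\<Sum>i<p. \<bar>f y i - f x i\<bar>)) \<longlongrightarrow> 0) (at_right 0)"
      by (rule tendsto_eq_intros refl | simp)+
    show "\<forall>\<^sub>F \<epsilon> in at_right 0. x \<noteq> y \<longrightarrow>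
      \<epsilon> * (\<Sum>i<p. \<bar>f y i - f x i\<bar>) < dot p (\<lambda>i. f y i - f x i) (\<lambda>i. f y i - f x i)"
      using order_tendstoD(2)[OF lim assms(2)[OF xy]] by (cases "x = y") auto
  qed
  then have "\<forall>\<^sub>F \<epsilon> in at_right 0. \<epsilon> > 0 \<and> (\<forall>x\<in>S. \<forall>y\<in>S. x \<noteq> y \<longrightarrow>
    \<epsilon> * (\<Sum>i<p. \<bar>f y i - f x i\<bar>) < dot p (\<lambda>i. f y i - f x i) (\<lambda>i. f y i - f x i))"
    using eventually_at_right_less by (rule eventually_elim2) auto
  then show ?thesis
    using eventually_happens' trivial_limit_at_right_real by blast
qed

text \<open>Words of length \<open>N\<close> are mapped to the cells, in a grid of mesh \<open>\<epsilon>\<close>, that contain their dyadic sums. If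
two words had the same cell, all coordinates of their sums would differ by at most \<open>\<epsilon>\<close>; the choice of
\<open>\<epsilon>\<close> makes this incompatible with \<open>dyadic_sums_separated\<close>. So the number of words is at most the
number of cells that meet the cube containing all the sums.\<close>

lemma card_power_le:
  fixes f :: "'a \<Rightarrow> nat \<Rightarrow> real" and R :: nat
  assumes "finite S" "no_obtuse_angle p S f" "\<epsilon> > 0"
    and mesh: "\<And>x y. x \<in> S \<Longrightarrow> y \<in> S \<Longrightarrow> x \<noteq> y \<Longrightarrow>
      \<epsilon> * (\<Sum>i<p. \<bar>f y i - f x i\<bar>) < dot p (\<lambda>i. f y i - f x i) (\<lambda>i. f y i - f x i)"
    and R: "\<And>x i. x \<in> S \<Longrightarrow> i < p \<Longrightarrow> \<bar>f x i\<bar> \<le> \<epsilon> * real R"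
  shows "card S ^ N \<le> (2 * (2 ^ N * R) + 1) ^ p"
proof -
  define s where "s a i = (\<Sum>k<N. 2 ^ k * f (a k) i)" for a :: "nat \<Rightarrow> 'a" and i
  define \<Phi> where "\<Phi> a = (\<lambda>i\<in>{..<p}. \<lfloor>s a i / \<epsilon>\<rfloor>)" for a
  define W where "W = PiE {..<N} (\<lambda>_. S)"
  define T where "T = PiE {..<p} (\<lambda>_. {- int (2 ^ N * R)..int (2 ^ N * R)})"
  have "inj_on \<Phi> W"
  proof (rule inj_onI, rule ccontr)
    fix a b assume ab: "a \<in> W" "b \<in> W" "\<Phi> a = \<Phi> b" "a \<noteq> b"
    have "\<exists>k<N. a k \<noteq> b k"
      using ab(4) PiE_ext[OF ab(1,2)[unfolded W_def]] by blast
    then obtain x y where xy: "x \<in> S" "y \<in> S" "x \<noteq> y" and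
      le: "dot p (\<lambda>i. f y i - f x i) (\<lambda>i. f y i - f x i) \<le>
        dot p (\<lambda>i. \<Sum>k<N. 2 ^ k * (f (b k) i - f (a k) i)) (\<lambda>i. f y i - f x i)"
      using dyadic_sums_separated[OF assms(2), of a N b] ab(1,2) by (auto simp: W_def PiE_def)
    note le
    also have "dot p (\<lambda>i. \<Sum>k<N. 2 ^ k * (f (b k) i - f (a k) i)) (\<lambda>i. f y i - f x i)
        = (\<Sum>i<p. (s b i - s a i) * (f y i - f x i))"
      by (simp add: dot_def s_def right_diff_distrib sum_subtractf)
    also have "\<dots> \<le> (\<Sum>i<p. \<epsilon> * \<bar>f y i - f x i\<bar>)"
    proof (rule sum_mono)
      fix i assume "i \<in> {..<p}"
      then have "\<lfloor>s a i / \<epsilon>\<rfloor> = \<lfloor>s b i / \<epsilon>\<rfloor>"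
        using fun_cong[OF ab(3), of i] by (simp add: \<Phi>_def)
      then have "\<bar>s b i / \<epsilon> - s a i / \<epsilon>\<bar> \<le> 1" by linarith
      then have "\<bar>s b i - s a i\<bar> \<le> \<epsilon>"
        using assms(3) by (simp flip: diff_divide_distrib add: abs_divide)
      then have "\<bar>s b i - s a i\<bar> * \<bar>f y i - f x i\<bar> \<le> \<epsilon> * \<bar>f y i - f x i\<bar>"
        by (intro mult_right_mono) auto
      then show "(s b i - s a i) * (f y i - f x i) \<le> \<epsilon> * \<bar>f y i - f x i\<bar>"
        by (metis abs_ge_self abs_mult order_trans)
    qed
    also have "\<dots> < dot p (\<lambda>i. f y i - f x i) (\<lambda>i. f y i - f x i)"
      using mesh[OF xy] by (simp add: sum_distrib_left)
    finally show False by simp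
  qed
  moreover have "\<Phi> ` W \<subseteq> T"
  proof
    fix g assume "g \<in> \<Phi> ` W"
    then obtain a where a: "a \<in> W" "g = \<Phi> a" by blast
    have "\<lfloor>s a i / \<epsilon>\<rfloor> \<in> {- int (2 ^ N * R)..int (2 ^ N * R)}" if "i < p" for i
    proof -
      have "\<bar>s a i\<bar> \<le> (\<Sum>k<N. \<bar>2 ^ k * f (a k) i\<bar>)"
        unfolding s_def by (rule sum_abs)
      also have "\<dots> \<le> (\<Sum>k<N. 2 ^ k * (\<epsilon> * real R))"
        using a(1) R that by (intro sum_mono) (auto simp: abs_mult W_def)
      also have "\<dots> = (2 ^ N - 1) * (\<epsilon> * real R)"
        unfolding sum_distrib_right[symmetric] by (simp add: geometric_sum)
      also have "\<dots> \<le> \<epsilon> * (2 ^ N * real R)"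
        using assms(3) by (simp add: algebra_simps)
      finally have "\<bar>s a i / \<epsilon>\<bar> \<le> real_of_int (int (2 ^ N * R))"
        using assms(3) by (simp add: abs_divide pos_divide_le_eq mult.commute)
      then show ?thesis by (simp only: atLeastAtMost_iff) linarith
    qed
    then show "g \<in> T" by (auto simp: a(2) T_def \<Phi>_def)
  qed
  moreover have "finite T" by (simp add: T_def finite_PiE)
  ultimately have "card W \<le> card T" by (rule card_inj_on_le)
  moreover have "card W = card S ^ N" by (simp add: W_def card_PiE)
  moreover have "card T = (2 * (2 ^ N * R) + 1) ^ p"
  proof -
    have "nat (int k - - int k + 1) = 2 * k + 1" for k by simp
    then show ?thesis unfolding T_def by (simp only: card_PiE finite_lessThan prod_constant
        card_lessThan card_atLeastAtMost_int)
  qed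
  ultimately show ?thesis by simp
qed

text \<open>The Danzer--Gruenbaum bound. As \<open>card S ^ N \<le> A * (2 ^ p) ^ N\<close> holds with the same \<open>A\<close> for all \<open>N\<close>,
the ratio \<open>card S / 2 ^ p\<close> cannot exceed \<open>1\<close>.\<close>

lemma card_le_if_no_obtuse_angle:
  assumes "finite S" "no_obtuse_angle p S f"
    and "\<And>x y. x \<in> S \<Longrightarrow> y \<in> S \<Longrightarrow> x \<noteq> y \<Longrightarrow> 0 < dot p (\<lambda>i. f y i - f x i) (\<lambda>i. f y i - f x i)"
  shows "card S \<le> 2 ^ p"
proof (rule ccontr)
  assume "\<not> card S \<le> 2 ^ p"
  then have "real (card S) > 2 ^ p" by (metis not_le of_nat_less_iff of_nat_numeral of_nat_power)
  then have gt: "real (card S) / 2 ^ p > 1" by simp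
  obtain \<epsilon> where \<epsilon>: "\<epsilon> > 0" "\<And>x y. x \<in> S \<Longrightarrow> y \<in> S \<Longrightarrow> x \<noteq> y \<Longrightarrow>
      \<epsilon> * (\<Sum>i<p. \<bar>f y i - f x i\<bar>) < dot p (\<lambda>i. f y i - f x i) (\<lambda>i. f y i - f x i)"
    using exists_separating_mesh[of S p f, OF assms(1,3)] by blast
  have "\<forall>\<^sub>F R in sequentially. \<forall>x\<in>S. \<forall>i\<in>{..<p}. \<bar>f x i\<bar> / \<epsilon> \<le> real R"
    by (intro eventually_ball_finite ballI assms(1) finite_lessThan)
      (rule filterlim_real_sequentially[unfolded filterlim_at_top, rule_format])
  then obtain R where "\<And>x i. x \<in> S \<Longrightarrow> i < p \<Longrightarrow> \<bar>f x i\<bar> / \<epsilon> \<le> real R"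
    unfolding eventually_sequentially by blast
  then have R: "\<And>x i. x \<in> S \<Longrightarrow> i < p \<Longrightarrow> \<bar>f x i\<bar> \<le> \<epsilon> * real R"
    using \<epsilon>(1) by (simp add: pos_divide_le_eq mult.commute)
  define A where "A = (2 * R + 1) ^ p"
  have bound: "(real (card S) / 2 ^ p) ^ N \<le> real A" for N
  proof -
    have "card S ^ N \<le> (2 * (2 ^ N * R) + 1) ^ p"
      using card_power_le[OF assms(1,2) \<epsilon> R] by simp
    also have "\<dots> \<le> (2 ^ N * (2 * R + 1)) ^ p"
      by (intro power_mono) (auto simp: algebra_simps)
    also have "\<dots> = (2 ^ p) ^ N * A"
      by (simp only: A_def power_mult_distrib power_mult[symmetric] mult.commute[of N p])
    finally have "real (card S ^ N) \<le> real ((2 ^ p) ^ N * A)" by (simp only: of_nat_le_iff)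
    then show ?thesis by (simp add: power_divide pos_divide_le_eq mult.commute)
  qed
  obtain N where "real A < (real (card S) / 2 ^ p) ^ N"
    using real_arch_pow[OF gt] by blast
  with bound[of N] show False by simp
qed

section \<open>Spherical embeddings of finite hyperbolic point sets\<close>

text \<open>Gram vectors of \<open>\<rho> - D / 2\<close> all have squared norm \<open>\<rho>\<close>, and their squared distances are
\<open>2 * \<rho> - 2 * (\<rho> - D x y / 2) = D x y\<close>.\<close>

lemma embeds_in_sphere_if_psd:
  assumes "finite S" "\<rho> > 0" "psd_on S (\<lambda>x y. \<rho> - D x y / 2)" "\<And>x. x \<in> S \<Longrightarrow> D x x = 0"
  shows "embeds_in_sphere S (\<lambda>x y. sqrt (D x y)) (card S)"
proof -
  obtain f :: "'a \<Rightarrow> nat \<Rightarrow> real" where f0: "\<And>x i. x \<in> S \<Longrightarrow> i \<ge> card S \<Longrightarrow> f x i = 0"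
    and f: "\<And>x y. x \<in> S \<Longrightarrow> y \<in> S \<Longrightarrow> \<rho> - D x y / 2 = (\<Sum>i<card S. f x i * f y i)"
    using psd_on_gram[OF assms(1,3)] by blast
  have sq: "(\<Sum>i<card S. (f x i)\<^sup>2) = \<rho>" if "x \<in> S" for x
    using f[OF that that] assms(4)[OF that] by (simp add: power2_eq_square)
  have "(\<Sum>i<card S. (f x i - f y i)\<^sup>2) = D x y" if "x \<in> S" "y \<in> S" for x y
  proof -
    have "(\<Sum>i<card S. (f x i - f y i)\<^sup>2) = (\<Sum>i<card S. (f x i)\<^sup>2) + (\<Sum>i<card S. (f y i)\<^sup>2)
        - 2 * (\<Sum>i<card S. f x i * f y i)"
      by (simp add: power2_diff sum.distrib sum_subtractf sum_distrib_left mult.assoc)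
    then show ?thesis using sq that f[OF that, symmetric] by simp
  qed
  then show ?thesis
    unfolding embeds_in_sphere_def eucl_dist_def L2_set_def
    using f0 assms(2) sq
    by (intro exI[of _ f] exI[of _ "\<lambda>_. 0"] exI[of _ "sqrt \<rho>"])
      (auto simp: topspace_Euclidean_space)
qed

text \<open>By the law of cosines, \<open>D y z \<le> D y x + D z x\<close> says that the angle at \<open>f x\<close> between \<open>f y\<close> and \<open>f z\<close>
is not obtuse, since \<open>D\<close> is the squared euclidean distance.\<close>

lemma card_le_if_embeds_sqrt_metric:
  assumes "finite S" "embeds_in_sphere S (\<lambda>x y. sqrt (D x y)) p"
    and "\<And>x y. x \<in> S \<Longrightarrow> y \<in> S \<Longrightarrow> x \<noteq> y \<Longrightarrow> 0 < D x y"
    and "\<And>x y. x \<in> S \<Longrightarrow> y \<in> S \<Longrightarrow> 0 \<le> D x y"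
    and "\<And>x y z. x \<in> S \<Longrightarrow> y \<in> S \<Longrightarrow> z \<in> S \<Longrightarrow> D y z \<le> D y x + D z x"
  shows "card S \<le> 2 ^ p"
proof -
  obtain f where f: "\<And>x y. x \<in> S \<Longrightarrow> y \<in> S \<Longrightarrow> eucl_dist p (f x) (f y) = sqrt (D x y)"
    using assms(2) unfolding embeds_in_sphere_def by blast
  have dist: "dot p (\<lambda>i. f x i - f y i) (\<lambda>i. f x i - f y i) = D x y" if "x \<in> S" "y \<in> S" for x y
    using f[OF that] by (simp add: eucl_dist_def L2_set_def dot_def power2_eq_square)
  have "0 \<le> dot p (\<lambda>i. f z i - f x i) (\<lambda>i. f y i - f x i)"
    if "x \<in> S" "y \<in> S" "z \<in> S" for x y z
  proof -
    have "2 * dot p (\<lambda>i. f z i - f x i) (\<lambda>i. f y i - f x i) = D y x + D z x - D y z"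
      unfolding dist[OF that(2,1), symmetric] dist[OF that(3,1), symmetric]
        dist[OF that(2,3), symmetric] dot_def
      by (simp only: sum.distrib[symmetric] sum_subtractf[symmetric] sum_distrib_left)
        (intro sum.cong refl, simp add: algebra_simps)
    then show ?thesis using assms(5)[OF that] by simp
  qed
  then have "no_obtuse_angle p S f" unfolding no_obtuse_angle_def by blast
  then show ?thesis
    using assms(1,3) dist by (intro card_le_if_no_obtuse_angle[where f = f]) auto
qed

theorem corollary3p2:
  fixes n m :: nat and S :: "(nat \<Rightarrow> real) set set"
  assumes "n \<ge> 1"
    and "m \<ge> 1"
    and "S \<subseteq> hyp_space n"
    and "finite S"
    and "card S = m"
  shows "(\<exists>p. embeds_in_sphere S (\<lambda>x y. sqrt (hyp_dist n x y)) p) \<and>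
         (\<forall>p. embeds_in_sphere S (\<lambda>x y. sqrt (hyp_dist n x y)) p \<longrightarrow> real p \<ge> log 2 (real m))"
proof (intro conjI allI impI)
  obtain \<rho> where "\<rho> > 0" "psd_on S (\<lambda>X Y. \<rho> - hyp_dist n X Y / 2)"
    using psd_on_const_minus_half_hyp_dist[OF assms(4,3)] by blast
  moreover have "hyp_dist n X X = 0" if X: "X \<in> S" for X
  proof -
    obtain x where x: "x \<in> hyperboloid n" "X = proj_class x"
      using hyp_space_representative X assms(3) by blast
    then show ?thesis
      using hyp_dist_hyperboloid[OF x(1) x(1)] hyperboloidD(1)[OF x(1)] by simp
  qed
  ultimately show "\<exists>p. embeds_in_sphere S (\<lambda>x y. sqrt (hyp_dist n x y)) p"
    using embeds_in_sphere_if_psd[OF assms(4)] by blast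
next
  fix p assume emb: "embeds_in_sphere S (\<lambda>x y. sqrt (hyp_dist n x y)) p"
  have H: "X \<in> hyp_space n" if "X \<in> S" for X using that assms(3) by blast
  have "card S \<le> 2 ^ p"
  proof (rule card_le_if_embeds_sqrt_metric[OF assms(4) emb])
    show "hyp_dist n Y Z \<le> hyp_dist n Y X + hyp_dist n Z X" if "X \<in> S" "Y \<in> S" "Z \<in> S" for X Y Z
      using hyp_dist_triangle[OF H H H, OF that(2,1,3)] hyp_dist_commute[OF H H, OF that(1,3)] by simp
  qed (simp_all add: H hyp_dist_pos hyp_dist_nonneg)
  then have "real m \<le> 2 powr real p"
    using assms(5) by (simp add: powr_realpow)
  then show "real p \<ge> log 2 (real m)"
    using assms(2) by (simp add: log_le_iff)
qed

end
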